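(* Let $n \geq 0$ and $0 \leq s \leq \lfloor n/2 \rfloor$ be integers. Then the incomplete tribonacci polynomial $T_{n+1}^{(s)}(x)$ is the distribution of the statistic $2\delta+\nu$ on $\mathcal{T}_n^{(s)}$; that is, $$T_{n+1}^{(s)}(x)=\sum_{\pi\in\mathcal{T}_n^{(s)}}x^{2\delta(\pi)+\nu(\pi)}.$$
   Context: For integers $n\ge 0$ and $0\le s\le \lfloor n/2\rfloor$, the incomplete tribonacci polynomial is defined by $$T_{n+1}^{(s)}(x)=\sum_{i=0}^{s}\sum_{j=0}^i \binom{i}{j}\binom{n-i-j}{i}x^{2n-3(i+j)}.$$ A square, domino, or tromino is, respectively, a tile covering 1, 2, or 3 consecutive positions. A (linear) tiling of length $n$ is a covering of the positions $1,2,\ldots,n$ (written in a row) by non-overlapping squares, dominos and trominos, tiles of the same kind being indistinguishable; equivalently, it is a word in the letters $r$ (square, length 1), $d$ (domino, length 2), $t$ (tromino, length 3) of total length $n$. The set of all tilings of length $n$ is $\mathcal{T}_n$ (with $\mathcal{T}_0$ consisting of the empty tiling). A longer piece is a domino or a tromino. $\mathcal{T}_n^{(s)}$ is the subset of $\mathcal{T}_n$ consisting of tilings containing at most $s$ longer pieces. For a tiling $\pi$, $\delta(\pi)$ is the number of squares in $\pi$ and $\nu(\pi)$ is the number of dominos in $\pi$. *)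

theory Defs
  imports "HOL-Computational_Algebra.Polynomial"
begin

text \<open>
  \<open>inc_trib_poly s m\<close> is the polynomial \<open>T\<^sub>m\<^sup>(\<^sup>s\<^sup>)(x)\<close>; it is meaningful for
  \<open>m = n + 1\<close> and \<open>s \<le> n div 2\<close>. In this range \<open>n - i - j\<close> does not truncate;
  \<open>2 * n - 3 * (i + j)\<close> truncates only in terms whose coefficient is zero, as the
  lemma below shows.
\<close>

definition inc_trib_poly :: "nat \<Rightarrow> nat \<Rightarrow> int poly" where
  "inc_trib_poly s m = (let n = m - 1 in
     \<Sum>i = 0..s. \<Sum>j = 0..i.
       monom (int ((i choose j) * ((n - i - j) choose i))) (2 * n - 3 * (i + j)))"

lemma inc_trib_poly_exponent:
  fixes n i j :: nat
  assumes "i \<le> n div 2" "j \<le> i"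
  shows "i + j \<le> n" and "(n - i - j) choose i \<noteq> 0 \<Longrightarrow> 3 * (i + j) \<le> 2 * n"
proof -
  show sum_le: "i + j \<le> n" using assms by linarith
  assume "(n - i - j) choose i \<noteq> 0"
  then have "i \<le> n - i - j" by (metis binomial_eq_0 not_le)
  with sum_le have "2 * i + j \<le> n" by linarith
  then show "3 * (i + j) \<le> 2 * n" using assms(2) by presburger
qed

datatype tile = Square | Domino | Tromino

primrec tile_length :: "tile \<Rightarrow> nat" where
  "tile_length Square = 1"
| "tile_length Domino = 2"
| "tile_length Tromino = 3"

text \<open>A tiling is encoded as the word of its tiles, read from left to right.\<close>

definition tilings :: "nat \<Rightarrow> tile list set" where
  "tilings n = {\<pi>. (\<Sum>p\<leftarrow>\<pi>. tile_length p) = n}"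

definition num_squares :: "tile list \<Rightarrow> nat" where
  "num_squares \<pi> = count_list \<pi> Square"

definition num_dominos :: "tile list \<Rightarrow> nat" where
  "num_dominos \<pi> = count_list \<pi> Domino"

definition num_longer :: "tile list \<Rightarrow> nat" where
  "num_longer \<pi> = count_list \<pi> Domino + count_list \<pi> Tromino"

definition tilings_at_most :: "nat \<Rightarrow> nat \<Rightarrow> tile list set" where
  "tilings_at_most s n = {\<pi> \<in> tilings n. num_longer \<pi> \<le> s}"

lemma length_le_tile_length: "length \<pi> \<le> (\<Sum>p\<leftarrow>\<pi>. tile_length p)"
proof (induction \<pi>)
  case (Cons p \<pi>)
  then show ?case by (cases p) auto
qed simp

lemma finite_tilings: "finite (tilings n)"
proof (rule finite_subset)
  have "finite (UNIV :: tile set)"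
    by (rule finite_subset[of _ "{Square, Domino, Tromino}"]) (auto intro: tile.exhaust)
  then show "finite {\<pi>. set \<pi> \<subseteq> (UNIV :: tile set) \<and> length \<pi> \<le> n}"
    by (rule finite_lists_length_le)
  show "tilings n \<subseteq> {\<pi>. set \<pi> \<subseteq> UNIV \<and> length \<pi> \<le> n}"
    using length_le_tile_length by (auto simp: tilings_def)
qed

text \<open>In particular, sums over \<open>tilings_at_most s n\<close> are genuine finite sums.\<close>

lemma finite_tilings_at_most: "finite (tilings_at_most s n)"
  using finite_tilings by (simp add: tilings_at_most_def)

end

theory Submission
  imports Defs "HOL-Combinatorics.Multiset_Permutations"
begin

text \<open>
  Sort the tilings by the number \<open>i\<close> of longer pieces and the number \<open>j \<le> i\<close> of trominos among
  them. Both numbers fix the whole tile content: the \<open>i - j\<close> dominos and \<open>j\<close> trominos cover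
  \<open>2 * i + j\<close> positions, which leaves \<open>n - 2 * i - j\<close> squares. Hence all tilings in a class have
  the same weight \<open>2 * (n - 2 * i - j) + (i - j) = 2 * n - 3 * (i + j)\<close>, and the class consists of
  the arrangements of a word of \<open>n - i - j\<close> letters with this content: choose the places of the
  longer pieces, then the trominos among these. This gives
  \<open>(n - i - j choose i) * (i choose j)\<close> tilings (\<open>card_words_with_content\<close>,
  \<open>card_tilings_by_pieces\<close>). If \<open>2 * i + j > n\<close> there are no such tilings, and the binomial
  coefficient vanishes as well. Summing the classes yields the polynomial.
\<close>

text \<open>
  The number of arrangements is a trinomial coefficient, which factors into two binomial
  coefficients.
\<close>

lemma card_words_with_content:
  "card {\<pi>. count_list \<pi> Square = a \<and> count_list \<pi> Domino = b \<and> count_list \<pi> Tromino = c}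
     = ((a + b + c) choose (b + c)) * ((b + c) choose c)"
proof -
  let ?M = "replicate_mset a Square + replicate_mset b Domino + replicate_mset c Tromino"
  have "count_list \<pi> Square = a \<and> count_list \<pi> Domino = b \<and> count_list \<pi> Tromino = c
      \<longleftrightarrow> mset \<pi> = ?M" for \<pi>
  proof
    assume counts: "count_list \<pi> Square = a \<and> count_list \<pi> Domino = b \<and> count_list \<pi> Tromino = c"
    show "mset \<pi> = ?M"
    proof (rule multiset_eqI)
      show "count (mset \<pi>) p = count ?M p" for p
        using counts by (cases p) (auto simp: count_mset)
    qed
  next
    assume "mset \<pi> = ?M"
    then show "count_list \<pi> Square = a \<and> count_list \<pi> Domino = b \<and> count_list \<pi> Tromino = c"
      by (simp flip: count_mset)
  qed
  then have words: "{\<pi>. count_list \<pi> Square = a \<and> count_list \<pi> Domino = b \<and> count_list \<pi> Tromino = c}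
      = permutations_of_multiset ?M"
    by (simp add: permutations_of_multiset_def)
  have "(\<Prod>p\<in>set_mset ?M. fact (count ?M p) :: nat)
      = (\<Prod>p\<in>{Square, Domino, Tromino}. fact (count ?M p))"
    by (rule prod.mono_neutral_left) (auto split: if_splits)
  then have factorials: "(\<Prod>p\<in>set_mset ?M. fact (count ?M p) :: nat) = fact a * fact b * fact c"
    by simp
  have "fact (b + c) * fact a * ((a + b + c) choose (b + c)) = (fact (a + b + c) :: nat)"
    using binomial_fact_lemma[of "b + c" "a + b + c"] by simp
  moreover have "fact c * fact b * ((b + c) choose c) = (fact (b + c) :: nat)"
    using binomial_fact_lemma[of c "b + c"] by simp
  ultimately have "fact (a + b + c)
      = ((a + b + c) choose (b + c)) * ((b + c) choose c) * (fact a * fact b * fact c :: nat)"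
    by (metis mult.assoc mult.commute)
  then show ?thesis
    unfolding words by (simp add: card_permutations_of_multiset(1) factorials)
qed

lemma sum_tile_length:
  "(\<Sum>p\<leftarrow>\<pi>. tile_length p)
     = count_list \<pi> Square + 2 * count_list \<pi> Domino + 3 * count_list \<pi> Tromino"
proof (induction \<pi>)
  case (Cons p \<pi>)
  then show ?case by (cases p) auto
qed simp

lemma card_tilings_by_pieces:
  assumes "j \<le> i"
  shows "card {\<pi> \<in> tilings n. num_longer \<pi> = i \<and> count_list \<pi> Tromino = j}
     = (i choose j) * ((n - i - j) choose i)"
proof (cases "2 * i + j \<le> n")
  case True
  have "{\<pi> \<in> tilings n. num_longer \<pi> = i \<and> count_list \<pi> Tromino = j}
      = {\<pi>. count_list \<pi> Square = n - 2 * i - j \<and> count_list \<pi> Domino = i - j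
             \<and> count_list \<pi> Tromino = j}"
    using True assms by (auto simp: tilings_def num_longer_def sum_tile_length)
  moreover have "n - 2 * i - j + (i - j) + j = n - i - j"
    using True assms by linarith
  ultimately show ?thesis
    using assms by (simp add: card_words_with_content)
next
  case False
  have "{\<pi> \<in> tilings n. num_longer \<pi> = i \<and> count_list \<pi> Tromino = j} = {}"
    using False by (auto simp: tilings_def num_longer_def sum_tile_length)
  moreover have "(n - i - j) choose i = 0"
    \<comment> \<open>If \<open>i + j > n\<close>, then \<open>n - i - j\<close> truncates to \<open>0\<close>; this is still below \<open>i\<close>, since
      \<open>i = 0\<close> would force \<open>j = 0\<close>.\<close>
    using False assms by (intro binomial_eq_0) linarith
  ultimately show ?thesis by (simp only: card.empty mult_0_right)
qed

lemma statistic_by_pieces: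
  assumes "\<pi> \<in> tilings n"
  shows "2 * num_squares \<pi> + num_dominos \<pi> = 2 * n - 3 * (num_longer \<pi> + count_list \<pi> Tromino)"
  using assms
  by (simp add: tilings_def num_squares_def num_dominos_def num_longer_def sum_tile_length)

theorem theorem2p1:
  fixes n s :: nat
  assumes "s \<le> n div 2"
  shows "inc_trib_poly s (n + 1) =
    (\<Sum>\<pi>\<in>tilings_at_most s n. monom 1 (2 * num_squares \<pi> + num_dominos \<pi>))"
proof -
  let ?weight = "\<lambda>\<pi>. monom 1 (2 * num_squares \<pi> + num_dominos \<pi>) :: int poly"
  let ?pieces = "\<lambda>\<pi>. (num_longer \<pi>, count_list \<pi> Tromino)"
  let ?I = "Sigma {0..s} (\<lambda>i. {0..i})"
  have class_sum: "(\<Sum>\<pi>\<in>{\<pi> \<in> tilings_at_most s n. ?pieces \<pi> = (i, j)}. ?weight \<pi>)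
      = monom (int ((i choose j) * ((n - i - j) choose i))) (2 * n - 3 * (i + j))"
    if "i \<le> s" "j \<le> i" for i j
  proof -
    let ?C = "{\<pi> \<in> tilings n. num_longer \<pi> = i \<and> count_list \<pi> Tromino = j}"
    have "{\<pi> \<in> tilings_at_most s n. ?pieces \<pi> = (i, j)} = ?C"
      using that by (auto simp: tilings_at_most_def)
    then have "(\<Sum>\<pi>\<in>{\<pi> \<in> tilings_at_most s n. ?pieces \<pi> = (i, j)}. ?weight \<pi>)
        = (\<Sum>\<pi>\<in>?C. monom 1 (2 * n - 3 * (i + j)))"
      by (intro sum.cong) (auto simp: statistic_by_pieces)
    also have "\<dots> = monom (int (card ?C)) (2 * n - 3 * (i + j))"
      by (simp add: of_nat_poly smult_monom)
    finally show ?thesis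
      using that by (simp only: card_tilings_by_pieces)
  qed
  have "(\<Sum>\<pi>\<in>tilings_at_most s n. ?weight \<pi>)
      = (\<Sum>y\<in>?I. \<Sum>\<pi>\<in>{\<pi> \<in> tilings_at_most s n. ?pieces \<pi> = y}. ?weight \<pi>)"
    by (intro sum.group[symmetric] finite_tilings_at_most)
      (auto simp: tilings_at_most_def num_longer_def)
  also have "\<dots> = (\<Sum>(i, j)\<in>?I.
      monom (int ((i choose j) * ((n - i - j) choose i))) (2 * n - 3 * (i + j)))"
    using class_sum by (intro sum.cong) auto
  also have "\<dots> = inc_trib_poly s (n + 1)"
    by (simp add: inc_trib_poly_def sum.Sigma)
  finally show ?thesis by simp
qed

end
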